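(* Let $\{\boldsymbol{f}^{(t)}\}_{t=0,1,2,\dots}$ be the sequence of flows generated by the algorithm "PDR via Exact Subproblem Optimization". Then the corresponding sequence of global objective function values $\{z(\boldsymbol{f}^{(t)})\}$ is monotonically non-increasing, that is, $$z(\boldsymbol{f}^{(t+1)})\le z(\boldsymbol{f}^{(t)}),\qquad \forall t\ge 0.$$
   Context: Setting. $G(V,E)$ is a finite directed graph; $\delta^+(i)=\{j : (i,j)\in E\}$, $\delta^-(i)=\{j : (j,i)\in E\}$, and $\delta_i=|\delta^+(i)|+|\delta^-(i)|$ is the degree of vertex $i$, with $\delta_i\ge 1$ for every $i\in V$. Each edge has a capacity $u_{ij}\in\mathbb{Q}$, $u_{ij}>0$. There is a finite set of commodities $\mathcal{K}=\{1,\dots,K\}$; commodity $k$ has an origin $s_k\in V$, a destination $t_k\in V$ with $s_k\ne t_k$, and a demand $d_k$ (a real number). For a family $\boldsymbol{f}=(f_{ij,k})_{(i,j)\in E,\,k\in\mathcal{K}}$ of nonnegative reals put $$\Delta_{ik}=\sum_{j\in\delta^-(i)} f_{ji,k}-\sum_{j\in\delta^+(i)} f_{ij,k}+\hat\Delta_{ik},$$ where $\hat\Delta_{ik}=d_k$ if $i=s_k$, $\hat\Delta_{ik}=-d_k$ if $i=t_k$, and $\hat\Delta_{ik}=0$ otherwise; the height is $h_{ik}=\Delta_{ik}/\delta_i$, and the congestion is $\psi_{ij}=\max\bigl(0,\sum_{k\in\mathcal{K}} f_{ij,k}-u_{ij}\bigr)$. The global objective function is $$z(\boldsymbol{f})=\frac12\sum_{(i,j)\in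 E}\Bigl[\psi_{ij}^2+\sum_{k\in\mathcal{K}}h_{ik}^2+\sum_{k\in\mathcal{K}}h_{jk}^2\Bigr]=\frac12\sum_{(i,j)\in E}\psi_{ij}^2+\frac12\sum_{i\in V,\,k\in\mathcal{K}}\delta_i h_{ik}^2 .$$ Algorithm (PDR via Exact Subproblem Optimization). Start from $\boldsymbol{f}^{(0)}=0$. At iteration $t$, compute the heights $h_{ik}^{(t)}$ from $\boldsymbol{f}^{(t)}$ by the formulas above. Then, simultaneously and independently for every edge $(i,j)\in E$, let $(f_{ij,k}^{(t+1)})_{k\in\mathcal{K}}$ (together with an auxiliary variable $r_{ij}$) be the optimal solution of the quadratic program $$\min\ \frac12\Bigl[\bigl(\sum_{k\in\mathcal{K}} f_{ij,k}^{(t+1)}+r_{ij}-u_{ij}\bigr)^2+\sum_{k\in\mathcal{K}}\bigl(h_{ik}^{(t)}+f_{ij,k}^{(t)}-f_{ij,k}^{(t+1)}\bigr)^2+\sum_{k\in\mathcal{K}}\bigl(h_{jk}^{(t)}-f_{ij,k}^{(t)}+f_{ij,k}^{(t+1)}\bigr)^2\Bigr]$$ subject to $f_{ij,k}^{(t+1)}\ge 0$ for all $k\in\mathcal{K}$ and $r_{ij}\ge 0$. (The algorithm's stopping test, which halts when $|z(\boldsymbol{f}^{(t)})-z(\boldsymbol{f}^{(t-1)})|$ falls below a tolerance or an iteration limit is reached, does not affect the update rule; the sequence is the one produced by iterating the update.) *)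

theory Defs
  imports Complex_Main "Graph_Theory.Pair_Digraph"
begin

text \<open>
  Arcs are pairs of vertices, so there are no parallel arcs; antiparallel arcs and loops are
  allowed. A loop counts twice in the degree of its vertex.

  Capacities \<open>u i j\<close>, flows \<open>f i j k\<close> and demands \<open>d k\<close> are total functions; only their values
  for arcs \<open>(i, j)\<close> and commodities \<open>k\<close> in \<open>{1..K}\<close> matter.
\<close>

locale multicommodity_network = pair_fin_digraph G
  for G :: "'a pair_pre_digraph" +
  fixes u :: "'a \<Rightarrow> 'a \<Rightarrow> real"
    and K :: nat
    and s t :: "nat \<Rightarrow> 'a"
    and d :: "nat \<Rightarrow> real"
  assumes degree_pos: "i \<in> pverts G \<Longrightarrow> in_degree G i + out_degree G i \<ge> 1"
    and capacity_rat: "(i, j) \<in> parcs G \<Longrightarrow> u i j \<in> \<rat>"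
    and capacity_pos: "(i, j) \<in> parcs G \<Longrightarrow> u i j > 0"
    and origin_in_verts: "k \<in> {1..K} \<Longrightarrow> s k \<in> pverts G"
    and destination_in_verts: "k \<in> {1..K} \<Longrightarrow> t k \<in> pverts G"
    and origin_neq_destination: "k \<in> {1..K} \<Longrightarrow> s k \<noteq> t k"
begin

definition successors :: "'a \<Rightarrow> 'a set" where
  "successors i = {j. (i, j) \<in> parcs G}"

definition predecessors :: "'a \<Rightarrow> 'a set" where
  "predecessors i = {j. (j, i) \<in> parcs G}"

definition degree :: "'a \<Rightarrow> nat" where
  "degree i = out_degree G i + in_degree G i"

definition net_demand :: "'a \<Rightarrow> nat \<Rightarrow> real" where
  "net_demand i k = (if i = s k then d k else if i = t k then - d k else 0)"

definition excess :: "('a \<Rightarrow> 'a \<Rightarrow> nat \<Rightarrow> real) \<Rightarrow> 'a \<Rightarrow> nat \<Rightarrow> real" where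
  "excess f i k =
    (\<Sum>j\<in>predecessors i. f j i k) - (\<Sum>j\<in>successors i. f i j k) + net_demand i k"

definition height :: "('a \<Rightarrow> 'a \<Rightarrow> nat \<Rightarrow> real) \<Rightarrow> 'a \<Rightarrow> nat \<Rightarrow> real" where
  "height f i k = excess f i k / real (degree i)"

definition congestion :: "('a \<Rightarrow> 'a \<Rightarrow> nat \<Rightarrow> real) \<Rightarrow> 'a \<Rightarrow> 'a \<Rightarrow> real" where
  "congestion f i j = max 0 ((\<Sum>k\<in>{1..K}. f i j k) - u i j)"

definition global_objective :: "('a \<Rightarrow> 'a \<Rightarrow> nat \<Rightarrow> real) \<Rightarrow> real" where
  "global_objective f = 1/2 * (\<Sum>(i, j)\<in>parcs G. (congestion f i j)\<^sup>2
     + (\<Sum>k\<in>{1..K}. (height f i k)\<^sup>2) + (\<Sum>k\<in>{1..K}. (height f j k)\<^sup>2))"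

text \<open>
  The quadratic program of the arc \<open>(i, j)\<close>: \<open>f\<close> is the current flow, \<open>g k\<close> the new flow of
  commodity \<open>k\<close> on that arc, and \<open>r\<close> the slack variable.
\<close>

definition subproblem_objective ::
  "('a \<Rightarrow> 'a \<Rightarrow> nat \<Rightarrow> real) \<Rightarrow> 'a \<Rightarrow> 'a \<Rightarrow> (nat \<Rightarrow> real) \<Rightarrow> real \<Rightarrow> real" where
  "subproblem_objective f i j g r = 1/2 * (((\<Sum>k\<in>{1..K}. g k) + r - u i j)\<^sup>2
     + (\<Sum>k\<in>{1..K}. (height f i k + f i j k - g k)\<^sup>2)
     + (\<Sum>k\<in>{1..K}. (height f j k - f i j k + g k)\<^sup>2))"

definition subproblem_feasible :: "(nat \<Rightarrow> real) \<Rightarrow> real \<Rightarrow> bool" where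
  "subproblem_feasible g r \<longleftrightarrow> (\<forall>k\<in>{1..K}. g k \<ge> 0) \<and> r \<ge> 0"

definition subproblem_optimal ::
  "('a \<Rightarrow> 'a \<Rightarrow> nat \<Rightarrow> real) \<Rightarrow> 'a \<Rightarrow> 'a \<Rightarrow> (nat \<Rightarrow> real) \<Rightarrow> real \<Rightarrow> bool" where
  "subproblem_optimal f i j g r \<longleftrightarrow> subproblem_feasible g r \<and>
     (\<forall>g' r'. subproblem_feasible g' r' \<longrightarrow>
        subproblem_objective f i j g r \<le> subproblem_objective f i j g' r')"

definition pdr_sequence :: "(nat \<Rightarrow> 'a \<Rightarrow> 'a \<Rightarrow> nat \<Rightarrow> real) \<Rightarrow> bool" where
  "pdr_sequence f \<longleftrightarrow>
     (\<forall>(i, j)\<in>parcs G. \<forall>k\<in>{1..K}. f 0 i j k = 0) \<and>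
     (\<forall>n. \<forall>(i, j)\<in>parcs G. \<exists>r. subproblem_optimal (f n) i j (f (Suc n) i j) r)"

lemma degree_eq_card:
  "degree i = card (successors i) + card (predecessors i)"
proof -
  have "out_arcs G i = (\<lambda>j. (i, j)) ` successors i" "in_arcs G i = (\<lambda>j. (j, i)) ` predecessors i"
    unfolding out_arcs_def in_arcs_def successors_def predecessors_def by auto
  then show ?thesis
    unfolding degree_def out_degree_def in_degree_def
    by (simp add: card_image inj_on_def)
qed

lemma global_objective_vertex_form:
  "global_objective f = 1/2 * (\<Sum>(i, j)\<in>parcs G. (congestion f i j)\<^sup>2)
     + 1/2 * (\<Sum>i\<in>pverts G. \<Sum>k\<in>{1..K}. real (degree i) * (height f i k)\<^sup>2)"
proof -
  define H where "H i = (\<Sum>k\<in>{1..K}. (height f i k)\<^sup>2)" for i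
  have out: "(\<Sum>e\<in>parcs G. H (fst e)) = (\<Sum>i\<in>pverts G. real (card (successors i)) * H i)"
  proof -
    have "parcs G = Sigma (pverts G) successors"
      unfolding successors_def using in_arcsD1 by auto
    moreover have "finite (successors i)" for i
      by (rule finite_surj[OF pair_finite_arcs, of _ snd]) (force simp: successors_def)
    ultimately show ?thesis
      using pair_finite_verts sum.Sigma[of "pverts G" successors "\<lambda>i _. H i"]
      by (simp add: split_def)
  qed
  have inn: "(\<Sum>e\<in>parcs G. H (snd e)) = (\<Sum>i\<in>pverts G. real (card (predecessors i)) * H i)"
  proof -
    have "parcs G = prod.swap ` Sigma (pverts G) predecessors"
      unfolding predecessors_def using in_arcsD2 by force
    then have "(\<Sum>e\<in>parcs G. H (snd e)) = (\<Sum>e\<in>Sigma (pverts G) predecessors. H (fst e))"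
      by (simp add: sum.reindex)
    moreover have "finite (predecessors i)" for i
      by (rule finite_surj[OF pair_finite_arcs, of _ fst]) (force simp: predecessors_def)
    ultimately show ?thesis
      using pair_finite_verts sum.Sigma[of "pverts G" predecessors "\<lambda>i _. H i"]
      by (simp add: split_def)
  qed
  have "global_objective f = 1/2 * (\<Sum>(i, j)\<in>parcs G. (congestion f i j)\<^sup>2)
     + 1/2 * ((\<Sum>e\<in>parcs G. H (fst e)) + (\<Sum>e\<in>parcs G. H (snd e)))"
    unfolding global_objective_def H_def by (simp add: split_def sum.distrib algebra_simps)
  also have "(\<Sum>e\<in>parcs G. H (fst e)) + (\<Sum>e\<in>parcs G. H (snd e))
      = (\<Sum>i\<in>pverts G. \<Sum>k\<in>{1..K}. real (degree i) * (height f i k)\<^sup>2)"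
    unfolding out inn degree_eq_card
    by (simp add: H_def sum.distrib distrib_right sum_distrib_left)
  finally show ?thesis .
qed

end

end

theory Submission
  imports Defs
begin

text \<open>
  Write \<open>x i j k\<close> for the change of the flow of commodity \<open>k\<close> on the arc \<open>(i, j)\<close> in one
  iteration. All arcs change at once, so the subproblems do not see each other's changes: the
  subproblem of \<open>(i, j)\<close> predicts the height \<open>h i k - x i j k\<close> at its tail and
  \<open>h j k + x i j k\<close> at its head, as if this arc had moved the height of its endpoints on its own
  and by its whole flow change. Dividing the excess by the degree makes these predictions
  consistent: the true new height of a vertex is the arithmetic mean of the predictions made at
  the \<open>degree i\<close> arc ends at \<open>i\<close>. By convexity of the square,
  \<open>degree i * h' i k^2\<close> is at most the sum of the squared predictions at \<open>i\<close>
  (\<open>degree_height_square_le\<close>). Summed over all vertices and regrouped by arcs, this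
  bounds the new global objective by the sum of the subproblem objectives at their chosen points
  (\<open>global_objective_le_sum_subproblem\<close>).

  Conversely, each subproblem admits the point that leaves the flow unchanged and takes the best
  slack; its value is the contribution of the arc to the old global objective
  (\<open>subproblem_objective_unchanged\<close>). Optimality on every arc then closes the chain. The
  unchanged flow is feasible because every iterate is nonnegative.
\<close>

text \<open>
  The tangent of the square at the mean lies below the square; summed over the sample, the
  linear terms cancel.
\<close>

lemma card_mult_square_mean_le:
  fixes y :: "'b \<Rightarrow> real" and z :: "'c \<Rightarrow> real"
  assumes mean: "(\<Sum>a\<in>A. y a) + (\<Sum>b\<in>B. z b) = (real (card A) + real (card B)) * m"
  shows "(real (card A) + real (card B)) * m\<^sup>2 \<le> (\<Sum>a\<in>A. (y a)\<^sup>2) + (\<Sum>b\<in>B. (z b)\<^sup>2)"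
proof -
  have tangent: "2 * m * v - m\<^sup>2 \<le> v\<^sup>2" for v :: real
    using zero_le_power2[of "v - m"] by (simp add: power2_diff algebra_simps)
  have "(real (card A) + real (card B)) * m\<^sup>2
      = 2 * m * ((\<Sum>a\<in>A. y a) + (\<Sum>b\<in>B. z b)) - (real (card A) + real (card B)) * m\<^sup>2"
    unfolding mean by (simp add: power2_eq_square algebra_simps)
  also have "\<dots> = (\<Sum>a\<in>A. 2 * m * y a - m\<^sup>2) + (\<Sum>b\<in>B. 2 * m * z b - m\<^sup>2)"
    by (simp add: sum_subtractf algebra_simps flip: sum_distrib_left sum_distrib_right)
  also have "\<dots> \<le> (\<Sum>a\<in>A. (y a)\<^sup>2) + (\<Sum>b\<in>B. (z b)\<^sup>2)"
    by (intro add_mono sum_mono tangent)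
  finally show ?thesis .
qed

context multicommodity_network
begin

lemma sum_arcs_by_tail:
  "(\<Sum>(i, j)\<in>parcs G. F i j) = (\<Sum>i\<in>pverts G. \<Sum>j\<in>successors i. F i j)"
proof -
  have "parcs G = Sigma (pverts G) successors"
    unfolding successors_def using in_arcsD1 by auto
  moreover have "finite (successors i)" for i
    by (rule finite_surj[OF pair_finite_arcs, of _ snd]) (force simp: successors_def)
  ultimately show ?thesis
    using pair_finite_verts by (simp add: sum.Sigma)
qed

lemma sum_arcs_by_head:
  "(\<Sum>(i, j)\<in>parcs G. F i j) = (\<Sum>j\<in>pverts G. \<Sum>i\<in>predecessors j. F i j)"
proof -
  have "parcs G = prod.swap ` Sigma (pverts G) predecessors"
    unfolding predecessors_def using in_arcsD2 by force
  then have "(\<Sum>(i, j)\<in>parcs G. F i j) = (\<Sum>(j, i)\<in>Sigma (pverts G) predecessors. F i j)"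
    by (simp add: sum.reindex split_def)
  moreover have "finite (predecessors i)" for i
    by (rule finite_surj[OF pair_finite_arcs, of _ fst]) (force simp: predecessors_def)
  ultimately show ?thesis
    using pair_finite_verts by (simp add: sum.Sigma)
qed

text \<open>
  The heights predicted at the arc ends at \<open>i\<close> add up to \<open>degree i\<close> times the true new height,
  because the old height is counted once per arc end and the flow changes add up to the change of
  the excess. A loop contributes one prediction as an outgoing and one as an incoming arc,
  in agreement with its double weight in the degree.
\<close>

lemma degree_height_square_le:
  assumes "i \<in> pverts G"
  shows "real (degree i) * (height g i k)\<^sup>2
    \<le> (\<Sum>j\<in>successors i. (height f i k + f i j k - g i j k)\<^sup>2)
      + (\<Sum>j\<in>predecessors i. (height f i k - f j i k + g j i k)\<^sup>2)"
proof -
  have deg: "real (degree i) \<noteq> 0"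
    using degree_pos[OF assms] by (simp add: degree_def)
  have excess: "excess f i k = real (degree i) * height f i k" for f
    using deg by (simp add: height_def)
  have "(\<Sum>j\<in>successors i. height f i k + f i j k - g i j k)
      + (\<Sum>j\<in>predecessors i. height f i k - f j i k + g j i k)
      = real (degree i) * height f i k + (excess g i k - excess f i k)"
    unfolding degree_eq_card
    by (simp add: sum.distrib sum_subtractf excess_def algebra_simps)
  also have "\<dots> = real (degree i) * height g i k"
    by (simp add: excess)
  finally show ?thesis
    unfolding degree_eq_card of_nat_add by (rule card_mult_square_mean_le)
qed

text \<open>A nonnegative slack can absorb unused capacity but cannot reduce an overload.\<close>

lemma congestion_square_le:
  assumes "0 \<le> r"
  shows "(congestion g i j)\<^sup>2 \<le> ((\<Sum>k\<in>{1..K}. g i j k) + r - u i j)\<^sup>2"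
proof (cases "(\<Sum>k\<in>{1..K}. g i j k) - u i j \<le> 0")
  case True
  then show ?thesis by (simp add: congestion_def)
next
  case False
  with assms show ?thesis
    unfolding congestion_def by (intro power_mono) auto
qed

lemma global_objective_le_sum_subproblem:
  assumes slack: "\<And>i j. (i, j) \<in> parcs G \<Longrightarrow> 0 \<le> r i j"
  shows "global_objective g \<le> (\<Sum>(i, j)\<in>parcs G. subproblem_objective f i j (g i j) (r i j))"
proof -
  let ?tail = "\<lambda>i j k. (height f i k + f i j k - g i j k)\<^sup>2"
  let ?head = "\<lambda>i j k. (height f j k - f i j k + g i j k)\<^sup>2"
  let ?load = "\<lambda>i j. ((\<Sum>k\<in>{1..K}. g i j k) + r i j - u i j)\<^sup>2"
  have "(\<Sum>i\<in>pverts G. \<Sum>k\<in>{1..K}. real (degree i) * (height g i k)\<^sup>2)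
      \<le> (\<Sum>i\<in>pverts G. \<Sum>k\<in>{1..K}.
          (\<Sum>j\<in>successors i. ?tail i j k) + (\<Sum>j\<in>predecessors i. ?head j i k))"
    by (intro sum_mono degree_height_square_le)
  also have "\<dots> = (\<Sum>i\<in>pverts G. \<Sum>j\<in>successors i. \<Sum>k\<in>{1..K}. ?tail i j k)
      + (\<Sum>i\<in>pverts G. \<Sum>j\<in>predecessors i. \<Sum>k\<in>{1..K}. ?head j i k)"
    unfolding sum.distrib by (intro arg_cong2[where f = "(+)"] sum.cong refl sum.swap)
  also have "\<dots> = (\<Sum>(i, j)\<in>parcs G. \<Sum>k\<in>{1..K}. ?tail i j k)
      + (\<Sum>(i, j)\<in>parcs G. \<Sum>k\<in>{1..K}. ?head i j k)"
    unfolding sum_arcs_by_tail[symmetric] sum_arcs_by_head[symmetric] ..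
  finally have heights: "(\<Sum>i\<in>pverts G. \<Sum>k\<in>{1..K}. real (degree i) * (height g i k)\<^sup>2)
      \<le> (\<Sum>(i, j)\<in>parcs G. \<Sum>k\<in>{1..K}. ?tail i j k)
        + (\<Sum>(i, j)\<in>parcs G. \<Sum>k\<in>{1..K}. ?head i j k)" .
  have loads: "(\<Sum>(i, j)\<in>parcs G. (congestion g i j)\<^sup>2) \<le> (\<Sum>(i, j)\<in>parcs G. ?load i j)"
    by (intro sum_mono, clarify) (intro congestion_square_le slack)
  have subproblems: "(\<Sum>(i, j)\<in>parcs G. subproblem_objective f i j (g i j) (r i j))
      = 1/2 * ((\<Sum>(i, j)\<in>parcs G. ?load i j)
        + ((\<Sum>(i, j)\<in>parcs G. \<Sum>k\<in>{1..K}. ?tail i j k)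
        + (\<Sum>(i, j)\<in>parcs G. \<Sum>k\<in>{1..K}. ?head i j k)))"
    unfolding subproblem_objective_def
    by (simp add: split_def sum.distrib sum_divide_distrib add_divide_distrib)
  show ?thesis
    unfolding global_objective_vertex_form subproblems
    by (subst distrib_left[symmetric]) (rule mult_left_mono[OF add_mono[OF loads heights]], simp)
qed

text \<open>
  The slack that fills the free capacity turns the load term into the squared congestion, so the
  sum of these values over all arcs is the global objective.
\<close>

lemma subproblem_objective_unchanged:
  "subproblem_objective f i j (f i j) (max 0 (u i j - (\<Sum>k\<in>{1..K}. f i j k)))
    = 1/2 * ((congestion f i j)\<^sup>2
      + (\<Sum>k\<in>{1..K}. (height f i k)\<^sup>2) + (\<Sum>k\<in>{1..K}. (height f j k)\<^sup>2))"
proof -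
  have "(\<Sum>k\<in>{1..K}. f i j k) + max 0 (u i j - (\<Sum>k\<in>{1..K}. f i j k)) - u i j
      = congestion f i j"
    by (simp add: congestion_def max_def)
  then show ?thesis
    unfolding subproblem_objective_def by simp
qed

lemma pdr_sequence_nonneg:
  assumes "pdr_sequence f" and "(i, j) \<in> parcs G" and "k \<in> {1..K}"
  shows "0 \<le> f n i j k"
proof (cases n)
  case 0
  with assms show ?thesis
    unfolding pdr_sequence_def by fastforce
next
  case (Suc m)
  from assms obtain r where "subproblem_optimal (f m) i j (f (Suc m) i j) r"
    unfolding pdr_sequence_def by fast
  with assms Suc show ?thesis
    unfolding subproblem_optimal_def subproblem_feasible_def by simp
qed

lemma global_objective_pdr_step:
  assumes "pdr_sequence f"
  shows "global_objective (f (Suc n)) \<le> global_objective (f n)"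
proof -
  have "\<forall>i j. \<exists>r. (i, j) \<in> parcs G \<longrightarrow> subproblem_optimal (f n) i j (f (Suc n) i j) r"
    using assms unfolding pdr_sequence_def by fast
  then obtain r where
    optimal: "\<And>i j. (i, j) \<in> parcs G \<Longrightarrow> subproblem_optimal (f n) i j (f (Suc n) i j) (r i j)"
    by metis
  let ?fill = "\<lambda>i j. max 0 (u i j - (\<Sum>k\<in>{1..K}. f n i j k))"
  have "global_objective (f (Suc n))
      \<le> (\<Sum>(i, j)\<in>parcs G. subproblem_objective (f n) i j (f (Suc n) i j) (r i j))"
    using optimal
    by (intro global_objective_le_sum_subproblem)
      (auto simp: subproblem_optimal_def subproblem_feasible_def)
  also have "\<dots> \<le> (\<Sum>(i, j)\<in>parcs G. subproblem_objective (f n) i j (f n i j) (?fill i j))"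
  proof (intro sum_mono, clarify)
    fix i j
    assume arc: "(i, j) \<in> parcs G"
    have "subproblem_feasible (f n i j) (?fill i j)"
      using pdr_sequence_nonneg[OF assms arc] by (simp add: subproblem_feasible_def)
    with optimal[OF arc]
    show "subproblem_objective (f n) i j (f (Suc n) i j) (r i j)
        \<le> subproblem_objective (f n) i j (f n i j) (?fill i j)"
      unfolding subproblem_optimal_def by blast
  qed
  also have "\<dots> = global_objective (f n)"
    unfolding global_objective_def subproblem_objective_unchanged
    by (simp add: split_def sum_divide_distrib)
  finally show ?thesis .
qed

end

theorem theorem3:
  fixes G :: "'a pair_pre_digraph"
    and u :: "'a \<Rightarrow> 'a \<Rightarrow> real"
    and K :: nat
    and s t :: "nat \<Rightarrow> 'a"
    and d :: "nat \<Rightarrow> real"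
    and f :: "nat \<Rightarrow> 'a \<Rightarrow> 'a \<Rightarrow> nat \<Rightarrow> real"
  assumes "multicommodity_network G u K s t"
    and "multicommodity_network.pdr_sequence G u K s t d f"
  shows "\<forall>n. multicommodity_network.global_objective G u K s t d (f (Suc n))
            \<le> multicommodity_network.global_objective G u K s t d (f n)"
  using multicommodity_network.global_objective_pdr_step[OF assms] by blast

end
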